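(* Let $S$ be a right group in which every maximal subgroup $H$ satisfies $|H| \leq 2$. Then $S$ is a stabilized semigroup with respect to $\{\mathcal{LI}, \mathcal{RI}\}$, and $S$ is a stabilized semigroup with respect to $\{\mathcal{LZ}, \mathcal{RZ}\}$.
   Context: A right group is a semigroup that is left cancellative ($ax=ay$ implies $x=y$) and right simple ($aS=S$ for all $a\in S$). For a set $S$ with a binary operation (written by juxtaposition) and $a\in S$, define the left identity set $\mathcal{LI}(a)=\{b\in S \mid ba=a\}$, the right identity set $\mathcal{RI}(a)=\{b\in S\mid ab=a\}$, the left zero set $\mathcal{LZ}(a)=\{b\in S\mid ba=b\}$ and the right zero set $\mathcal{RZ}(a)=\{b\in S\mid ab=b\}$. Each is viewed as a binary relation on $S$ (e.g. $a\,\mathcal{LI}\,b$ iff $b\in\mathcal{LI}(a)$). A semigroup $(S,\star)$ is a stabilized semigroup with respect to a family of such relations if, for every semigroup $(S,\star')$ on the same underlying set such that for each $\rho$ in the family and each $a\in S$ the set $\rho(a)$ computed with $\star$ equals the set $\rho(a)$ computed with $\star'$, one has $\star=\star'$. *)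

theory Defs
  imports "HOL-Algebra.Group"
begin

text \<open>The underlying set of a semigroup is a whole type, as for the locale \<^locale>\<open>semigroup\<close>.\<close>

locale right_group = semigroup +
  assumes left_cancellative: "\<And>a x y. a \<^bold>* x = a \<^bold>* y \<Longrightarrow> x = y"
    and right_simple: "\<And>a. {a \<^bold>* s |s. s \<in> UNIV} = UNIV"

definition subgroup_of_op :: "('a \<Rightarrow> 'a \<Rightarrow> 'a) \<Rightarrow> 'a set \<Rightarrow> bool" where
  "subgroup_of_op f H \<longleftrightarrow> (\<exists>e. group \<lparr>carrier = H, mult = f, one = e\<rparr>)"

definition maximal_subgroup_of_op :: "('a \<Rightarrow> 'a \<Rightarrow> 'a) \<Rightarrow> 'a set \<Rightarrow> bool" where
  "maximal_subgroup_of_op f H \<longleftrightarrow>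
     subgroup_of_op f H \<and> (\<forall>K. subgroup_of_op f K \<longrightarrow> H \<subseteq> K \<longrightarrow> K = H)"

definition LI :: "('a \<Rightarrow> 'a \<Rightarrow> 'a) \<Rightarrow> 'a \<Rightarrow> 'a set" where
  "LI f a = {b. f b a = a}"

definition RI :: "('a \<Rightarrow> 'a \<Rightarrow> 'a) \<Rightarrow> 'a \<Rightarrow> 'a set" where
  "RI f a = {b. f a b = a}"

definition LZ :: "('a \<Rightarrow> 'a \<Rightarrow> 'a) \<Rightarrow> 'a \<Rightarrow> 'a set" where
  "LZ f a = {b. f b a = b}"

definition RZ :: "('a \<Rightarrow> 'a \<Rightarrow> 'a) \<Rightarrow> 'a \<Rightarrow> 'a set" where
  "RZ f a = {b. f a b = b}"

text \<open>A member of the family \<open>R\<close> assigns to every operation a binary relation on the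
  underlying set, given by the sets of elements related to each \<open>a\<close>.\<close>

definition stabilized_semigroup ::
  "(('a \<Rightarrow> 'a \<Rightarrow> 'a) \<Rightarrow> 'a \<Rightarrow> 'a set) set \<Rightarrow> ('a \<Rightarrow> 'a \<Rightarrow> 'a) \<Rightarrow> bool" where
  "stabilized_semigroup R f \<longleftrightarrow>
     semigroup f \<and> (\<forall>g. semigroup g \<longrightarrow> (\<forall>\<rho>\<in>R. \<forall>a. \<rho> f a = \<rho> g a) \<longrightarrow> f = g)"

end

theory Submission
  imports Defs
begin

text \<open>Either of the families \<open>{LI, RI}\<close> and \<open>{LZ, RZ}\<close> records exactly for which \<open>x\<close>, \<open>y\<close> the
  product \<open>xy\<close> equals \<open>x\<close> and for which it equals \<open>y\<close>. Choose \<open>e\<close> with \<open>ye = y\<close>: then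
  \<open>H = {u. ue = u}\<close> is the maximal subgroup containing \<open>y\<close>. If \<open>xy \<noteq> y\<close> for the given operation,
  then also \<open>xy \<noteq> y\<close> for the other one; both products lie in \<open>H - {y}\<close>, which has at most
  one element.\<close>

context right_group
begin

lemma ex_right_factor: "\<exists>s. a \<^bold>* s = b"
  using right_simple[of a] by (simp add: set_eq_iff) metis

lemma idempotent_left_identity:
  assumes "e \<^bold>* e = e"
  shows "e \<^bold>* x = x"
proof (rule left_cancellative)
  show "e \<^bold>* (e \<^bold>* x) = e \<^bold>* x"
    by (simp add: assms flip: assoc)
qed

lemma right_identity_idempotent:
  assumes "y \<^bold>* e = y"
  shows "e \<^bold>* e = e"
proof (rule left_cancellative)
  show "y \<^bold>* (e \<^bold>* e) = y \<^bold>* e"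
    by (simp add: assms flip: assoc)
qed

text \<open>An idempotent is already a left identity of the whole semigroup, so membership only has
  to make it a right identity.\<close>

lemma group_of_idempotent:
  assumes e: "e \<^bold>* e = e"
  shows "group \<lparr>carrier = {u. u \<^bold>* e = u}, mult = (\<^bold>*), one = e\<rparr>"
proof (rule groupI, simp_all add: e assoc idempotent_left_identity[OF e])
  fix x assume x: "x \<^bold>* e = x"
  obtain s where s: "x \<^bold>* s = e"
    using ex_right_factor by blast
  \<comment> \<open>The factor \<open>e\<close> after \<open>s\<close> puts the inverse into the
    carrier; cancelling \<open>x\<close> makes this right inverse a left one.\<close>
  have "x \<^bold>* (s \<^bold>* e \<^bold>* x) = x \<^bold>* e"
    by (simp add: s e x idempotent_left_identity[OF e] flip: assoc)
  then have "s \<^bold>* e \<^bold>* x = e"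
    by (rule left_cancellative)
  then show "\<exists>y. y \<^bold>* e = y \<and> y \<^bold>* x = e"
    using e by (intro exI[of _ "s \<^bold>* e"]) (simp add: assoc)
qed

lemma maximal_subgroup_of_idempotent:
  assumes e: "e \<^bold>* e = e"
  shows "maximal_subgroup_of_op (\<^bold>*) {u. u \<^bold>* e = u}"
  unfolding maximal_subgroup_of_op_def
proof (intro conjI allI impI)
  show "subgroup_of_op (\<^bold>*) {u. u \<^bold>* e = u}"
    unfolding subgroup_of_op_def using group_of_idempotent[OF e] by blast
next
  fix K assume "subgroup_of_op (\<^bold>*) K" and sub: "{u. u \<^bold>* e = u} \<subseteq> K"
  then obtain i where "group \<lparr>carrier = K, mult = (\<^bold>*), one = i\<rparr>"
    unfolding subgroup_of_op_def by blast
  then interpret K: group "\<lparr>carrier = K, mult = (\<^bold>*), one = i\<rparr>" .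
  have "e \<in> K"
    using sub e by blast
  \<comment> \<open>The only idempotent of a group is its identity.\<close>
  then have "e = i"
    using K.l_cancel_one[of e e] e by simp
  then show "K = {u. u \<^bold>* e = u}"
    using sub K.r_one by auto
qed

lemma eq_if_same_fixed_products:
  assumes max_le_2: "\<And>H. maximal_subgroup_of_op (\<^bold>*) H \<Longrightarrow> finite H \<and> card H \<le> 2"
    and g: "semigroup g"
    and left: "\<And>x y. x \<^bold>* y = x \<longleftrightarrow> g x y = x"
    and right: "\<And>x y. x \<^bold>* y = y \<longleftrightarrow> g x y = y"
  shows "(\<^bold>*) = g"
proof (intro ext)
  fix x y
  obtain e where e: "y \<^bold>* e = y"
    using ex_right_factor by blast
  let ?H = "{u. u \<^bold>* e = u}"
  have "finite ?H \<and> card ?H \<le> 2"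
    by (rule max_le_2[OF maximal_subgroup_of_idempotent[OF right_identity_idempotent[OF e]]])
  \<comment> \<open>\<open>left\<close> carries the equation \<open>e\<close> to \<open>g\<close>,
    associativity of \<open>g\<close> extends it from \<open>y\<close> to \<open>g x y\<close>, and
    \<open>left\<close> used backwards then places \<open>g x y\<close> in
    \<open>?H\<close>.\<close>
  moreover have "g (g x y) e = g x y"
    using e left[of y e] by (simp add: semigroup.assoc[OF g])
  then have "{y, x \<^bold>* y, g x y} \<subseteq> ?H"
    using e left[of "g x y" e] by (simp add: assoc)
  ultimately have "card {y, x \<^bold>* y, g x y} \<le> 2"
    by (meson card_mono le_trans)
  then show "x \<^bold>* y = g x y"
    using right[of x y] by (cases "x \<^bold>* y = y") (auto simp: card_insert_if split: if_splits)
qed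

end

theorem theorem5p8:
  fixes f :: "'a \<Rightarrow> 'a \<Rightarrow> 'a"
  assumes "right_group f"
    and "\<And>H. maximal_subgroup_of_op f H \<Longrightarrow> finite H \<and> card H \<le> 2"
  shows "stabilized_semigroup {LI, RI} f \<and> stabilized_semigroup {LZ, RZ} f"
proof -
  interpret right_group f
    by fact
  have "f = g" if "semigroup g" "\<And>x y. f x y = x \<longleftrightarrow> g x y = x" "\<And>x y. f x y = y \<longleftrightarrow> g x y = y" for g
    using eq_if_same_fixed_products[OF assms(2) that] .
  then show ?thesis
    using semigroup_axioms
    by (simp add: stabilized_semigroup_def LI_def RI_def LZ_def RZ_def set_eq_iff)
qed

end
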